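(* Let $m,n,q$ be positive integers, and let $A\in\mathbb{R}^{m\times n}$ and $B\in\mathbb{R}^{n\times q}$. Then $P_{AB}(x,y)=P_A(x,y)\otimes P_B(x,y)$ in $\mathcal{P}_m^q$.
   Context: For positive integers $m,n$, $\mathcal{P}_m^n$ denotes the real vector space of polynomials in two variables $x,y$ of the form $P(x,y)=\sum_{k_1=0}^{m-1}\sum_{k_2=0}^{n-1}\lambda_{k_1,k_2}x^{k_1}y^{k_2}$ with $\lambda_{k_1,k_2}\in\mathbb{R}$. For $A=(a_{ij})\in\mathbb{R}^{m\times n}$, $P_A\in\mathcal{P}_m^n$ denotes the unique polynomial in $\mathcal{P}_m^n$ with $P_A(i,j)=a_{ij}$ for all $1\le i\le m$, $1\le j\le n$. The DP product of $P\in\mathcal{P}_m^n$ and $Q\in\mathcal{P}_n^q$ is $P(x,y)\otimes Q(x,y)=\sum_{k=1}^{n}P(x,k)\,Q(k,y)\in\mathcal{P}_m^q$. *)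

theory Defs
  imports "HOL-Computational_Algebra.Polynomial" "Jordan_Normal_Form.Matrix"
begin

text \<open>A polynomial in two variables \<open>x, y\<close> is a polynomial in \<open>y\<close> whose coefficients are
  polynomials in \<open>x\<close>; the monomial \<open>c x^k y^l\<close> is thus \<open>monom (monom c k) l\<close>.\<close>

definition poly_space :: "nat \<Rightarrow> nat \<Rightarrow> real poly poly set" where
  "poly_space m n =
    {P. \<exists>c :: nat \<Rightarrow> nat \<Rightarrow> real. P = (\<Sum>k<m. \<Sum>l<n. monom (monom (c k l) k) l)}"

definition eval_y :: "real poly poly \<Rightarrow> real \<Rightarrow> real poly" where
  "eval_y P b = poly P [:b:]" \<comment> \<open>\<open>P(x, b)\<close>, a polynomial in \<open>x\<close>\<close>

definition eval_x :: "real poly poly \<Rightarrow> real \<Rightarrow> real poly" where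
  "eval_x P a = map_poly (\<lambda>p. poly p a) P" \<comment> \<open>\<open>P(a, y)\<close>, a polynomial in \<open>y\<close>\<close>

definition eval_xy :: "real poly poly \<Rightarrow> real \<Rightarrow> real \<Rightarrow> real" where
  "eval_xy P a b = poly (eval_y P b) a"

text \<open>The two ways of regarding a univariate polynomial as a bivariate one.\<close>

definition in_x :: "real poly \<Rightarrow> real poly poly" where
  "in_x p = [:p:]"

definition in_y :: "real poly \<Rightarrow> real poly poly" where
  "in_y p = map_poly (\<lambda>c. [:c:]) p"

text \<open>The matrix entry \<open>a\<^sub>i\<^sub>j\<close> with \<open>i, j \<ge> 1\<close> is \<open>A $$ (i - 1, j - 1)\<close>, as indices of \<^typ>\<open>real mat\<close>
  start at 0. The polynomial is well defined by \<open>matrix_poly_ex1\<close> below.\<close>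

definition matrix_poly :: "real mat \<Rightarrow> real poly poly" where
  "matrix_poly A = (THE P. P \<in> poly_space (dim_row A) (dim_col A) \<and>
     (\<forall>i\<in>{1..dim_row A}. \<forall>j\<in>{1..dim_col A}.
        eval_xy P (real i) (real j) = A $$ (i - 1, j - 1)))"

text \<open>The DP product of \<open>P \<in> poly_space m n\<close> and \<open>Q \<in> poly_space n q\<close>. The inner dimension \<open>n\<close> is an
  explicit argument because it cannot be recovered from the polynomials themselves.\<close>

definition dp_product :: "nat \<Rightarrow> real poly poly \<Rightarrow> real poly poly \<Rightarrow> real poly poly" where
  "dp_product n P Q = (\<Sum>k=1..n. in_x (eval_y P (real k)) * in_y (eval_x Q (real k)))"

lemma eval_xy_sum_monom:
  "eval_xy (\<Sum>k<m. \<Sum>l<n. monom (monom (c k l) k) l) a b = (\<Sum>k<m. \<Sum>l<n. c k l * a ^ k * b ^ l)"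
  by (simp add: eval_xy_def eval_y_def poly_sum poly_monom poly_power)

lemma eval_xy_eq_poly_eval_x: "eval_xy P a b = poly (eval_x P a) b"
  by (induction P) (simp_all add: eval_xy_def eval_y_def eval_x_def map_poly_pCons)

lemma eval_xy_in_x: "eval_xy (in_x p) a b = poly p a"
  by (simp add: in_x_def eval_xy_def eval_y_def)

lemma eval_xy_in_y: "eval_xy (in_y p) a b = poly p b"
  by (induction p) (simp_all add: in_y_def eval_xy_def eval_y_def map_poly_pCons)

lemma eval_xy_dp_product:
  "eval_xy (dp_product n P Q) a b = (\<Sum>k=1..n. eval_xy P a (real k) * eval_xy Q (real k) b)"
proof -
  have "eval_xy (p * r) a b = eval_xy p a b * eval_xy r a b" for p r
    by (simp add: eval_xy_def eval_y_def)
  moreover have "eval_xy (dp_product n P Q) a b =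
      (\<Sum>k=1..n. eval_xy (in_x (eval_y P (real k)) * in_y (eval_x Q (real k))) a b)"
    by (simp add: dp_product_def eval_xy_def eval_y_def poly_sum)
  ultimately show ?thesis
    by (simp add: eval_xy_in_x eval_xy_in_y flip: eval_xy_eq_poly_eval_x)
      (simp add: eval_xy_def)
qed

lemma coeffs_zero_of_nodes:
  fixes c :: "nat \<Rightarrow> real"
  assumes "\<And>j. j \<in> {1..n} \<Longrightarrow> (\<Sum>k<n. c k * real j ^ k) = 0" and "k < n"
  shows "c k = 0"
proof -
  let ?p = "\<Sum>k<n. monom (c k) k"
  have co: "coeff ?p i = (if i < n then c i else 0)" for i
    by (simp add: coeff_sum)
  have "?p = 0"
  proof (rule ccontr)
    assume nz: "?p \<noteq> 0"
    have "degree ?p < n"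
      using assms(2) by (intro le_less_trans[OF degree_le[of "n - 1"]]) (auto simp: co)
    moreover have "card (real ` {1..n}) \<le> card {x. poly ?p x = 0}"
      using assms(1) nz by (intro card_mono poly_roots_finite) (auto simp: poly_sum poly_monom)
    ultimately show False
      using card_poly_roots_bound[OF nz] by (simp add: card_image)
  qed
  then show ?thesis using co[of k] assms(2) by simp
qed

lemma matrix_poly_ex1:
  "\<exists>!P. P \<in> poly_space (dim_row A) (dim_col A) \<and>
     (\<forall>i\<in>{1..dim_row A}. \<forall>j\<in>{1..dim_col A}.
        eval_xy P (real i) (real j) = A $$ (i - 1, j - 1))"
proof (rule ex_ex1I)
  let ?m = "dim_row A" and ?n = "dim_col A"
  define L :: "nat \<Rightarrow> nat \<Rightarrow> real poly" where
    "L n j = (\<Prod>r\<in>{1..n}-{j}. Polynomial.smult (1 / (real j - real r)) [:- real r, 1:])" for n j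
  have L_eval: "poly (L n j) (real i) = (if i = j then 1 else 0)"
    if "j \<in> {1..n}" "i \<in> {1..n}" for n i j
    using that by (auto simp: L_def poly_prod intro!: prod.neutral simp: divide_simps)
  have L_sum: "poly (L n j) x = (\<Sum>k<n. coeff (L n j) k * x ^ k)" if "j \<in> {1..n}" for n j x
  proof -
    have "degree (L n j) \<le> (\<Sum>r\<in>{1..n}-{j}. 1)"
      unfolding L_def
      by (intro order.trans[OF degree_prod_sum_le] sum_mono)
        (auto intro: order.trans[OF degree_smult_le])
    then have "degree (L n j) < n" using that by (auto simp: card_Diff_singleton)
    then show ?thesis
      unfolding poly_altdef by (intro sum.mono_neutral_left) (auto simp: coeff_eq_0)
  qed
  let ?c = "\<lambda>k l. \<Sum>i=1..?m. \<Sum>j=1..?n.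
    A $$ (i - 1, j - 1) * coeff (L ?m i) k * coeff (L ?n j) l"
  let ?P = "\<Sum>k<?m. \<Sum>l<?n. monom (monom (?c k l) k) l"
  have ev: "eval_xy ?P x y =
    (\<Sum>i=1..?m. \<Sum>j=1..?n. A $$ (i - 1, j - 1) * poly (L ?m i) x * poly (L ?n j) y)" for x y
  proof -
    have "eval_xy ?P x y = (\<Sum>k<?m. \<Sum>l<?n. \<Sum>i=1..?m. \<Sum>j=1..?n.
        A $$ (i - 1, j - 1) * (coeff (L ?m i) k * x ^ k) * (coeff (L ?n j) l * y ^ l))"
      by (simp add: eval_xy_sum_monom sum_distrib_left sum_distrib_right mult_ac)
    also have "\<dots> = (\<Sum>k<?m. \<Sum>i=1..?m. \<Sum>l<?n. \<Sum>j=1..?n.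
        A $$ (i - 1, j - 1) * (coeff (L ?m i) k * x ^ k) * (coeff (L ?n j) l * y ^ l))"
      by (intro sum.cong refl sum.swap)
    also have "\<dots> = (\<Sum>k<?m. \<Sum>i=1..?m. \<Sum>j=1..?n. \<Sum>l<?n.
        A $$ (i - 1, j - 1) * (coeff (L ?m i) k * x ^ k) * (coeff (L ?n j) l * y ^ l))"
      by (intro sum.cong refl sum.swap)
    also have "\<dots> = (\<Sum>i=1..?m. \<Sum>k<?m. \<Sum>j=1..?n. \<Sum>l<?n.
        A $$ (i - 1, j - 1) * (coeff (L ?m i) k * x ^ k) * (coeff (L ?n j) l * y ^ l))"
      by (rule sum.swap)
    also have "\<dots> = (\<Sum>i=1..?m. \<Sum>j=1..?n. \<Sum>k<?m. \<Sum>l<?n.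
        A $$ (i - 1, j - 1) * (coeff (L ?m i) k * x ^ k) * (coeff (L ?n j) l * y ^ l))"
      by (intro sum.cong refl sum.swap)
    also have "\<dots> = (\<Sum>i=1..?m. \<Sum>j=1..?n.
        A $$ (i - 1, j - 1) * poly (L ?m i) x * poly (L ?n j) y)"
      by (intro sum.cong refl)
        (simp only: L_sum sum_distrib_left sum_distrib_right mult.assoc, rule sum.swap)
    finally show ?thesis .
  qed
  have "eval_xy ?P (real i) (real j) = A $$ (i - 1, j - 1)"
    if "i \<in> {1..?m}" "j \<in> {1..?n}" for i j
  proof -
    have "eval_xy ?P (real i) (real j) =
      (\<Sum>i'=1..?m. \<Sum>j'=1..?n. if j = j' then (if i = i' then A $$ (i' - 1, j' - 1) else 0) else 0)"
      unfolding ev using that by (intro sum.cong refl) (simp add: L_eval)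
    then show ?thesis using that by simp
  qed
  moreover have "?P \<in> poly_space ?m ?n"
    unfolding poly_space_def by (intro CollectI exI[of _ ?c] refl)
  ultimately show "\<exists>P. P \<in> poly_space ?m ?n \<and>
     (\<forall>i\<in>{1..?m}. \<forall>j\<in>{1..?n}. eval_xy P (real i) (real j) = A $$ (i - 1, j - 1))"
    by (intro exI[of _ ?P] conjI ballI)
next
  let ?m = "dim_row A" and ?n = "dim_col A"
  fix P Q
  assume P: "P \<in> poly_space ?m ?n \<and>
     (\<forall>i\<in>{1..?m}. \<forall>j\<in>{1..?n}. eval_xy P (real i) (real j) = A $$ (i - 1, j - 1))"
    and Q: "Q \<in> poly_space ?m ?n \<and>
     (\<forall>i\<in>{1..?m}. \<forall>j\<in>{1..?n}. eval_xy Q (real i) (real j) = A $$ (i - 1, j - 1))"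
  obtain c d where c: "P = (\<Sum>k<?m. \<Sum>l<?n. monom (monom (c k l) k) l)"
    and d: "Q = (\<Sum>k<?m. \<Sum>l<?n. monom (monom (d k l) k) l)"
    using P Q unfolding poly_space_def by blast
  have zero: "(\<Sum>k<?m. (\<Sum>l<?n. (c k l - d k l) * real j ^ l) * real i ^ k) = 0"
    if "i \<in> {1..?m}" "j \<in> {1..?n}" for i j
  proof -
    have "eval_xy P (real i) (real j) - eval_xy Q (real i) (real j) = 0"
      using P Q that by simp
    then have "(\<Sum>k<?m. \<Sum>l<?n. c k l * real i ^ k * real j ^ l - d k l * real i ^ k * real j ^ l) = 0"
      unfolding c d eval_xy_sum_monom by (simp only: sum_subtractf)
    moreover have "c k l * real i ^ k * real j ^ l - d k l * real i ^ k * real j ^ l =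
        (c k l - d k l) * real j ^ l * real i ^ k" for k l
      by (simp add: algebra_simps)
    ultimately show ?thesis by (simp only: sum_distrib_right)
  qed
  have "c k l = d k l" if k: "k < ?m" and l: "l < ?n" for k l
  proof -
    have "(\<Sum>l<?n. (c k l - d k l) * real j ^ l) = 0" if "j \<in> {1..?n}" for j
      by (rule coeffs_zero_of_nodes[OF zero[OF _ that] k])
    then have "c k l - d k l = 0"
      by (rule coeffs_zero_of_nodes[OF _ l])
    then show ?thesis by simp
  qed
  then show "P = Q" unfolding c d by (intro sum.cong refl) simp
qed

end

theory Submission
  imports Defs
begin

text \<open>Interpolation on the grid \<open>{1..m} \<times> {1..q}\<close> is unique within \<^term>\<open>poly_space m q\<close>, so a
  polynomial of that space is the polynomial of the matrix of its grid values
  (\<open>matrix_poly_unique\<close>). The DP product of the polynomials of \<open>A\<close> and \<open>B\<close> sums over the inner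
  nodes \<open>1, \<dots>, n\<close>, so its value at \<open>(i, j)\<close> is the inner product of a row of \<open>A\<close> with a column
  of \<open>B\<close>, that is, an entry of \<open>A * B\<close>. It remains to see that the product
  lies in \<^term>\<open>poly_space m q\<close> (\<open>dp_product_in_poly_space\<close>): each summand is a polynomial in \<open>x\<close> of
  degree below \<open>m\<close> times a polynomial in \<open>y\<close> of degree below \<open>q\<close>.\<close>

text \<open>Membership in the space is a condition on single coefficients, hence easy to check for sums
  and for products whose coefficients factor.\<close>

lemma poly_space_iff_coeff:
  "P \<in> poly_space m n \<longleftrightarrow> (\<forall>k l. m \<le> k \<or> n \<le> l \<longrightarrow> coeff (coeff P l) k = 0)"
proof -
  have co: "coeff (coeff (\<Sum>k<m. \<Sum>l<n. monom (monom (c k l) k) l) j) i =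
      (if i < m \<and> j < n then c i j else 0)" for c :: "nat \<Rightarrow> nat \<Rightarrow> real" and i j
  proof -
    have "coeff (coeff (\<Sum>k<m. \<Sum>l<n. monom (monom (c k l) k) l) j) i =
        (\<Sum>k<m. \<Sum>l<n. if l = j then if k = i then c k l else 0 else 0)"
      unfolding coeff_sum by (intro sum.cong refl) simp
    then show ?thesis by (cases "j < n") auto
  qed
  show ?thesis
  proof
    assume "P \<in> poly_space m n"
    then show "\<forall>k l. m \<le> k \<or> n \<le> l \<longrightarrow> coeff (coeff P l) k = 0"
      unfolding poly_space_def using co by auto
  next
    assume "\<forall>k l. m \<le> k \<or> n \<le> l \<longrightarrow> coeff (coeff P l) k = 0"
    then have "P = (\<Sum>k<m. \<Sum>l<n. monom (monom (coeff (coeff P l) k) k) l)"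
      by (intro poly_eqI) (simp add: co[of "\<lambda>k l. coeff (coeff P l) k"] not_less)
    then show "P \<in> poly_space m n"
      unfolding poly_space_def by (intro CollectI exI[of _ "\<lambda>k l. coeff (coeff P l) k"])
  qed
qed

lemma coeff_in_x_times_in_y:
  "coeff (coeff (in_x p * in_y r) l) k = coeff p k * coeff r l"
  by (simp add: in_x_def in_y_def coeff_map_poly mult.commute)

lemma coeff_eval_y:
  "coeff (eval_y P b) k = (\<Sum>l\<le>degree P. coeff (coeff P l) k * b ^ l)"
  by (simp add: eval_y_def poly_altdef coeff_sum poly_const_pow mult.commute)

lemma coeff_eval_x: "coeff (eval_x P a) l = poly (coeff P l) a"
  by (simp add: eval_x_def coeff_map_poly)

text \<open>Substituting a number for one variable leaves the degree bound in the other intact, so the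
  product inherits its bound in \<open>x\<close> from the left factor and its bound in \<open>y\<close> from the right
  factor.\<close>

lemma dp_product_in_poly_space:
  assumes "P \<in> poly_space m n" and "Q \<in> poly_space n' q"
  shows "dp_product r P Q \<in> poly_space m q"
proof -
  have "coeff (eval_y P b) k = 0" if "m \<le> k" for b k
    using assms(1) that by (simp add: poly_space_iff_coeff coeff_eval_y)
  moreover have "coeff (eval_x Q a) l = 0" if "q \<le> l" for a l
  proof -
    have "coeff Q l = 0"
      using assms(2) that by (intro poly_eqI) (simp add: poly_space_iff_coeff)
    then show ?thesis by (simp add: coeff_eval_x)
  qed
  ultimately show ?thesis
    by (auto simp: poly_space_iff_coeff dp_product_def coeff_sum coeff_in_x_times_in_y
        intro!: sum.neutral)
qed

lemma matrix_poly_in_poly_space: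
  "matrix_poly A \<in> poly_space (dim_row A) (dim_col A)"
  using theI'[OF matrix_poly_ex1[of A]] by (simp add: matrix_poly_def)

lemma eval_xy_matrix_poly:
  assumes "i \<in> {1..dim_row A}" and "j \<in> {1..dim_col A}"
  shows "eval_xy (matrix_poly A) (real i) (real j) = A $$ (i - 1, j - 1)"
  using theI'[OF matrix_poly_ex1[of A]] assms by (simp add: matrix_poly_def)

lemma matrix_poly_unique:
  assumes "P \<in> poly_space (dim_row A) (dim_col A)"
    and "\<And>i j. i \<in> {1..dim_row A} \<Longrightarrow> j \<in> {1..dim_col A} \<Longrightarrow>
      eval_xy P (real i) (real j) = A $$ (i - 1, j - 1)"
  shows "matrix_poly A = P"
  unfolding matrix_poly_def by (rule the1_equality[OF matrix_poly_ex1]) (use assms in blast)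

theorem theorem4p4:
  fixes m n q :: nat and A B :: "real mat"
  assumes "m > 0" and "n > 0" and "q > 0"
    and "A \<in> carrier_mat m n" and "B \<in> carrier_mat n q"
  shows "matrix_poly (A * B) = dp_product n (matrix_poly A) (matrix_poly B)
    \<and> dp_product n (matrix_poly A) (matrix_poly B) \<in> poly_space m q"
proof -
  let ?D = "dp_product n (matrix_poly A) (matrix_poly B)"
  have A: "dim_row A = m" "dim_col A = n" and B: "dim_row B = n" "dim_col B = q"
    using assms by auto
  have D: "?D \<in> poly_space m q"
    using matrix_poly_in_poly_space[of A] matrix_poly_in_poly_space[of B]
    unfolding A B by (rule dp_product_in_poly_space)
  have "eval_xy ?D (real i) (real j) = (A * B) $$ (i - 1, j - 1)"
    if i: "i \<in> {1..m}" and j: "j \<in> {1..q}" for i j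
  proof -
    have "eval_xy ?D (real i) (real j) = (\<Sum>k=1..n. A $$ (i - 1, k - 1) * B $$ (k - 1, j - 1))"
      unfolding eval_xy_dp_product
      using i j by (intro sum.cong refl) (simp add: eval_xy_matrix_poly A B)
    \<comment> \<open>nodes start at 1, matrix indices at 0\<close>
    also have "\<dots> = (\<Sum>k=0..<n. A $$ (i - 1, k) * B $$ (k, j - 1))"
      by (rule sum.reindex_bij_witness[of _ Suc "\<lambda>k. k - 1"]) auto
    also have "\<dots> = (A * B) $$ (i - 1, j - 1)"
      using i j by (auto simp: scalar_prod_def A B intro!: sum.cong)
    finally show ?thesis .
  qed
  then have "matrix_poly (A * B) = ?D"
    using D by (intro matrix_poly_unique) (simp_all add: A B)
  then show ?thesis using D ..
qed

end
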